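(* Let $\Gamma=(V,E)$ be a point-transitive, reflexive, locally finite relation and let $v\in V$. Let $F\subset V$ satisfy $F\cap\Gamma^-(v)=\{v\}$. (i) If $F$ is finite, then $|\Gamma(F)\setminus F|\ge|\Gamma(v)|-1$. (ii) If $F$ is cofinite (i.e. $V\setminus F$ is finite), then $|\Gamma(F)\setminus F|\ge|\Gamma^-(v)|-1$.
   Context: A relation is a pair $\Gamma=(V,E)$ with $E\subset V\times V$; for $X\subset V$, $\Gamma(X)=\{y: (x,y)\in E \text{ for some } x\in X\}$, $\Gamma^-(X)=\{y:(y,x)\in E\text{ for some }x\in X\}$, $\Gamma(x)=\Gamma(\{x\})$. $\Gamma$ is reflexive if $(x,x)\in E$ for all $x$, and locally finite if $\Gamma(x)$ and $\Gamma^-(x)$ are finite for all $x$. An automorphism is a bijection $f:V\to V$ with $\Gamma(f(x))=f(\Gamma(x))$ for all $x$; $\Gamma$ is point-transitive if for all $x,y\in V$ there is an automorphism $f$ with $f(x)=y$. *)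

theory Defs
  imports Main
begin

definition is_relation :: "'a set \<Rightarrow> ('a \<times> 'a) set \<Rightarrow> bool" where
  "is_relation V E \<longleftrightarrow> E \<subseteq> V \<times> V"

definition out_nbhd :: "('a \<times> 'a) set \<Rightarrow> 'a set \<Rightarrow> 'a set" where
  "out_nbhd E X = {y. \<exists>x\<in>X. (x, y) \<in> E}"

definition in_nbhd :: "('a \<times> 'a) set \<Rightarrow> 'a set \<Rightarrow> 'a set" where
  "in_nbhd E X = {y. \<exists>x\<in>X. (y, x) \<in> E}"

definition rel_reflexive :: "'a set \<Rightarrow> ('a \<times> 'a) set \<Rightarrow> bool" where
  "rel_reflexive V E \<longleftrightarrow> (\<forall>x\<in>V. (x, x) \<in> E)"

definition locally_finite :: "'a set \<Rightarrow> ('a \<times> 'a) set \<Rightarrow> bool" where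
  "locally_finite V E \<longleftrightarrow>
     (\<forall>x\<in>V. finite (out_nbhd E {x}) \<and> finite (in_nbhd E {x}))"

definition rel_automorphism :: "'a set \<Rightarrow> ('a \<times> 'a) set \<Rightarrow> ('a \<Rightarrow> 'a) \<Rightarrow> bool" where
  "rel_automorphism V E f \<longleftrightarrow>
     bij_betw f V V \<and> (\<forall>x\<in>V. out_nbhd E {f x} = f ` out_nbhd E {x})"

definition point_transitive :: "'a set \<Rightarrow> ('a \<times> 'a) set \<Rightarrow> bool" where
  "point_transitive V E \<longleftrightarrow>
     (\<forall>x\<in>V. \<forall>y\<in>V. \<exists>f. rel_automorphism V E f \<and> f x = y)"

end

theory Submission
  imports Defs
begin

text \<open>
  Write \<open>\<partial>X = \<Gamma>(X) - X\<close>. The function \<open>X \<mapsto> |\<partial>X|\<close> is submodular and invariant under automorphisms.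
  Let \<open>F\<close> be a finite counterexample of least cardinality, let \<open>v\<close> be its point, and let \<open>X\<close> be a
  fragment, i.e. a finite nonempty set with \<open>\<Gamma>(X) \<noteq> V\<close> and \<open>|\<partial>X|\<close> minimal. If a translate \<open>gF\<close> with
  \<open>gv \<in> X\<close> were not contained in \<open>X\<close>, then \<open>gF \<inter> X\<close> would satisfy the theorem by minimality, and
  submodularity would force \<open>|\<partial>(gF \<union> X)| < |\<partial>X|\<close>. Hence \<open>F\<close> lies in the intersection of all
  translates of \<open>X\<close> that contain \<open>v\<close>. This is a finite block of imprimitivity, on which \<open>\<Gamma>\<close>
  restricts to a point-transitive relation for which \<open>F\<close> is still a counterexample.

  For infinite \<open>V\<close> this reduces the theorem to finite \<open>V\<close>. For finite \<open>V\<close> it permits an induction on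
  \<open>|V|\<close>, but \<open>gF \<union> X\<close> can be compared with \<open>X\<close> only if \<open>|X| + |F| \<le> |V| - |\<partial>X| + 1\<close>. If this fails,
  we pass to the converse relation: there \<open>V - \<Gamma>(X)\<close> is a fragment, \<open>{v} \<union> (V - \<Gamma>(F))\<close> is a
  counterexample, and counting shows that the corresponding inequality holds.
\<close>

section \<open>Neighbourhoods, boundaries and automorphisms\<close>

definition boundary :: "('a \<times> 'a) set \<Rightarrow> 'a set \<Rightarrow> 'a set" where
  "boundary E X = out_nbhd E X - X"

lemma out_nbhd_converse: "out_nbhd (E\<inverse>) = in_nbhd E"
  by (auto simp: fun_eq_iff out_nbhd_def in_nbhd_def)

lemma in_nbhd_converse: "in_nbhd (E\<inverse>) = out_nbhd E"
  by (auto simp: fun_eq_iff out_nbhd_def in_nbhd_def)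

lemma out_nbhd_eq_UN: "out_nbhd E X = (\<Union>x\<in>X. out_nbhd E {x})"
  by (auto simp: out_nbhd_def)

lemma out_nbhd_Un: "out_nbhd E (A \<union> B) = out_nbhd E A \<union> out_nbhd E B"
  by (auto simp: out_nbhd_def)

lemma out_nbhd_Int_subset: "out_nbhd E (A \<inter> B) \<subseteq> out_nbhd E A \<inter> out_nbhd E B"
  by (auto simp: out_nbhd_def)

lemma rel_automorphism_iff:
  assumes "E \<subseteq> V \<times> V"
  shows "rel_automorphism V E f \<longleftrightarrow>
    bij_betw f V V \<and> (\<forall>x\<in>V. \<forall>y\<in>V. (f x, f y) \<in> E \<longleftrightarrow> (x, y) \<in> E)"
proof
  assume "rel_automorphism V E f"
  then have bij: "bij_betw f V V"
    and image: "\<And>x. x \<in> V \<Longrightarrow> out_nbhd E {f x} = f ` out_nbhd E {x}"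
    by (auto simp: rel_automorphism_def)
  have "(f x, f y) \<in> E \<longleftrightarrow> (x, y) \<in> E" if "x \<in> V" "y \<in> V" for x y
  proof -
    have "(f x, f y) \<in> E \<longleftrightarrow> f y \<in> f ` out_nbhd E {x}"
      using image[OF \<open>x \<in> V\<close>] by (auto simp: out_nbhd_def)
    also have "\<dots> \<longleftrightarrow> y \<in> out_nbhd E {x}"
      using bij \<open>y \<in> V\<close> assms
      by (intro inj_on_image_mem_iff[where B = V]) (auto simp: bij_betw_def out_nbhd_def)
    finally show ?thesis by (simp add: out_nbhd_def)
  qed
  with bij show "bij_betw f V V \<and> (\<forall>x\<in>V. \<forall>y\<in>V. (f x, f y) \<in> E \<longleftrightarrow> (x, y) \<in> E)"
    by blast
next
  assume "bij_betw f V V \<and> (\<forall>x\<in>V. \<forall>y\<in>V. (f x, f y) \<in> E \<longleftrightarrow> (x, y) \<in> E)"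
  then have bij: "bij_betw f V V"
    and edges: "\<And>x y. x \<in> V \<Longrightarrow> y \<in> V \<Longrightarrow> (f x, f y) \<in> E \<longleftrightarrow> (x, y) \<in> E"
    by auto
  have "y \<in> f ` out_nbhd E {x}" if "x \<in> V" "(f x, y) \<in> E" for x y
  proof -
    have "y \<in> f ` V" using that assms bij by (auto simp: bij_betw_def)
    then show ?thesis using that edges by (auto simp: out_nbhd_def)
  qed
  moreover have "(f x, f y) \<in> E" if "x \<in> V" "(x, y) \<in> E" for x y
    using that edges assms by blast
  ultimately show "rel_automorphism V E f"
    using bij unfolding rel_automorphism_def by (auto simp: out_nbhd_def)
qed

lemma rel_automorphism_converse:
  assumes "E \<subseteq> V \<times> V"
  shows "rel_automorphism V (E\<inverse>) f \<longleftrightarrow> rel_automorphism V E f"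
proof -
  have "E\<inverse> \<subseteq> V \<times> V" using assms by auto
  then show ?thesis using assms by (auto simp: rel_automorphism_iff)
qed

lemma rel_automorphism_Restr:
  assumes "E \<subseteq> V \<times> V" "rel_automorphism V E f" "B \<subseteq> V" "f ` B = B"
  shows "rel_automorphism B (Restr E B) f"
proof -
  have bij: "bij_betw f V V" and edges: "\<forall>x\<in>V. \<forall>y\<in>V. (f x, f y) \<in> E \<longleftrightarrow> (x, y) \<in> E"
    using assms by (auto simp: rel_automorphism_iff)
  have "bij_betw f B B"
    using bij assms(3,4) by (rule bij_betw_subset)
  moreover have "\<forall>x\<in>B. \<forall>y\<in>B. (f x, f y) \<in> Restr E B \<longleftrightarrow> (x, y) \<in> Restr E B"
    using edges assms(3,4) by blast
  ultimately show ?thesis by (subst rel_automorphism_iff) auto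
qed

lemma out_nbhd_image:
  assumes "rel_automorphism V E f" "X \<subseteq> V"
  shows "out_nbhd E (f ` X) = f ` out_nbhd E X"
proof -
  have "out_nbhd E {f x} = f ` out_nbhd E {x}" if "x \<in> X" for x
    using that assms by (auto simp: rel_automorphism_def)
  then show ?thesis
    using out_nbhd_eq_UN[of E X] out_nbhd_eq_UN[of E "f ` X"] by auto
qed

section \<open>Reflexive locally finite relations\<close>

locale reflexive_locally_finite_relation =
  fixes V :: "'a set" and E :: "('a \<times> 'a) set"
  assumes relation: "is_relation V E"
    and reflexive: "rel_reflexive V E"
    and locally_finite: "locally_finite V E"
begin

lemma edges_subset: "E \<subseteq> V \<times> V"
  using relation by (simp add: is_relation_def)

lemma refl_edge: "x \<in> V \<Longrightarrow> (x, x) \<in> E"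
  using reflexive by (simp add: rel_reflexive_def)

lemma out_nbhd_subset: "out_nbhd E X \<subseteq> V"
  using edges_subset by (auto simp: out_nbhd_def)

lemma in_nbhd_subset: "in_nbhd E X \<subseteq> V"
  using edges_subset by (auto simp: in_nbhd_def)

lemma boundary_subset: "boundary E X \<subseteq> V"
  using out_nbhd_subset by (auto simp: boundary_def)

lemma subset_out_nbhd: "X \<subseteq> V \<Longrightarrow> X \<subseteq> out_nbhd E X"
  using refl_edge by (auto simp: out_nbhd_def)

lemma finite_out_nbhd:
  assumes "finite X" "X \<subseteq> V"
  shows "finite (out_nbhd E X)"
  using assms locally_finite by (subst out_nbhd_eq_UN) (auto simp: locally_finite_def)

lemma finite_boundary: "finite X \<Longrightarrow> X \<subseteq> V \<Longrightarrow> finite (boundary E X)"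
  by (simp add: boundary_def finite_out_nbhd)

lemma card_out_nbhd:
  assumes "finite X" "X \<subseteq> V"
  shows "card (out_nbhd E X) = card X + card (boundary E X)"
  using assms subset_out_nbhd[of X] finite_out_nbhd[of X]
  by (simp add: boundary_def card_Diff_subset card_mono)

lemma card_diff_out_nbhd:
  assumes "finite V" "X \<subseteq> V"
  shows "card (V - out_nbhd E X) + card X + card (boundary E X) = card V"
proof -
  have "finite X" using assms finite_subset by blast
  moreover have "V \<inter> out_nbhd E X = out_nbhd E X" using out_nbhd_subset by blast
  ultimately show ?thesis
    using card_Int_Diff[OF assms(1), of "out_nbhd E X"] card_out_nbhd[of X] assms(2) by simp
qed

lemma boundary_submodular:
  assumes "finite A" "A \<subseteq> V" "finite B" "B \<subseteq> V"
  shows "card (boundary E (A \<union> B)) + card (boundary E (A \<inter> B))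
    \<le> card (boundary E A) + card (boundary E B)"
proof -
  have "card (out_nbhd E (A \<inter> B)) \<le> card (out_nbhd E A \<inter> out_nbhd E B)"
    using assms by (intro card_mono out_nbhd_Int_subset) (simp add: finite_out_nbhd)
  moreover have "card (out_nbhd E A) + card (out_nbhd E B)
      = card (out_nbhd E (A \<union> B)) + card (out_nbhd E A \<inter> out_nbhd E B)"
    unfolding out_nbhd_Un using assms by (intro card_Un_Int finite_out_nbhd)
  moreover have "card A + card B = card (A \<union> B) + card (A \<inter> B)"
    using assms by (intro card_Un_Int)
  moreover have "card (out_nbhd E (A \<inter> B)) = card (A \<inter> B) + card (boundary E (A \<inter> B))"
    using assms by (intro card_out_nbhd) auto
  ultimately show ?thesis
    using assms card_out_nbhd[of A] card_out_nbhd[of B] card_out_nbhd[of "A \<union> B"] by simp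
qed

abbreviation aut :: "('a \<Rightarrow> 'a) \<Rightarrow> bool" where
  "aut \<equiv> rel_automorphism V E"

lemma aut_mem: "aut f \<Longrightarrow> x \<in> V \<Longrightarrow> f x \<in> V"
  by (auto simp: rel_automorphism_def bij_betw_def)

lemma aut_inj_on: "aut f \<Longrightarrow> X \<subseteq> V \<Longrightarrow> inj_on f X"
  by (auto simp: rel_automorphism_def bij_betw_def intro: inj_on_subset)

lemma aut_comp:
  assumes "aut f" "aut g"
  shows "aut (g \<circ> f)"
  using assms bij_betw_trans[of f V V g V] aut_mem[OF assms(1)]
  by (simp add: rel_automorphism_iff[OF edges_subset])

lemma in_nbhd_image:
  assumes "aut f" "X \<subseteq> V"
  shows "in_nbhd E (f ` X) = f ` in_nbhd E X"
proof -
  have "rel_automorphism V (E\<inverse>) f"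
    using assms(1) edges_subset by (simp add: rel_automorphism_converse)
  then show ?thesis
    using out_nbhd_image[of V "E\<inverse>" f X] assms(2) by (simp add: out_nbhd_converse)
qed

lemma boundary_image:
  assumes "aut f" "X \<subseteq> V"
  shows "boundary E (f ` X) = f ` boundary E X"
proof -
  have "f ` (out_nbhd E X - X) = f ` out_nbhd E X - f ` X"
    using assms(2) out_nbhd_subset[of X]
    by (intro inj_on_image_set_diff[OF aut_inj_on[OF assms(1) order_refl]]) auto
  then show ?thesis using assms by (simp add: boundary_def out_nbhd_image)
qed

lemma converse: "reflexive_locally_finite_relation V (E\<inverse>)"
proof
  show "is_relation V (E\<inverse>)" using relation by (auto simp: is_relation_def)
  show "rel_reflexive V (E\<inverse>)" using reflexive by (auto simp: rel_reflexive_def)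
  show "locally_finite V (E\<inverse>)"
    using locally_finite by (auto simp: locally_finite_def out_nbhd_converse in_nbhd_converse)
qed

lemma in_nbhd_diff_out_nbhd: "in_nbhd E (V - out_nbhd E X) \<subseteq> V - X"
  using edges_subset by (auto simp: in_nbhd_def out_nbhd_def)

end

section \<open>Point-transitive relations\<close>

locale point_transitive_relation = reflexive_locally_finite_relation +
  assumes point_transitive: "point_transitive V E"
begin

lemma obtain_aut:
  assumes "x \<in> V" "y \<in> V"
  obtains f where "aut f" "f x = y"
  using assms point_transitive by (auto simp: point_transitive_def)

lemma card_out_nbhd_singleton_eq:
  assumes "x \<in> V" "y \<in> V"
  shows "card (out_nbhd E {x}) = card (out_nbhd E {y})"
proof -
  obtain f where "aut f" "f x = y" using assms by (rule obtain_aut)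
  then have "out_nbhd E {y} = f ` out_nbhd E {x}"
    using out_nbhd_image[of V E f "{x}"] assms by simp
  then show ?thesis
    using card_image[OF aut_inj_on[OF \<open>aut f\<close> out_nbhd_subset]] by simp
qed

lemma point_transitive_relation_converse: "point_transitive_relation V (E\<inverse>)"
proof -
  interpret conv: reflexive_locally_finite_relation V "E\<inverse>" by (rule converse)
  show ?thesis
  proof
    show "point_transitive V (E\<inverse>)"
      using point_transitive edges_subset
      by (simp add: point_transitive_def rel_automorphism_converse)
  qed
qed

lemma card_edges:
  assumes "finite V" "x \<in> V"
  shows "card E = card V * card (out_nbhd E {x})"
proof -
  have "E = (SIGMA y:V. out_nbhd E {y})"
    using edges_subset by (auto simp: out_nbhd_def)
  then have "card E = card (SIGMA y:V. out_nbhd E {y})" by (rule arg_cong)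
  also have "\<dots> = (\<Sum>y\<in>V. card (out_nbhd E {y}))"
    using assms finite_out_nbhd by (intro card_SigmaI) auto
  also have "\<dots> = (\<Sum>y\<in>V. card (out_nbhd E {x}))"
    using assms by (intro sum.cong refl card_out_nbhd_singleton_eq)
  finally show ?thesis by simp
qed

lemma card_in_nbhd_singleton_eq:
  assumes "finite V" "x \<in> V"
  shows "card (in_nbhd E {x}) = card (out_nbhd E {x})"
proof -
  interpret conv: point_transitive_relation V "E\<inverse>"
    by (rule point_transitive_relation_converse)
  have "card V * card (in_nbhd E {x}) = card E"
    using conv.card_edges[OF assms] by (simp add: out_nbhd_converse)
  also have "\<dots> = card V * card (out_nbhd E {x})"
    using assms by (rule card_edges)
  finally show ?thesis using assms by auto
qed

lemma point_transitive_relation_Restr: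
  assumes "B \<subseteq> V"
    and "\<And>x y. x \<in> B \<Longrightarrow> y \<in> B \<Longrightarrow> \<exists>h. aut h \<and> h x = y \<and> h ` B = B"
  shows "point_transitive_relation B (Restr E B)"
proof
  show "is_relation B (Restr E B)" by (simp add: is_relation_def)
  show "rel_reflexive B (Restr E B)"
    using refl_edge assms(1) by (auto simp: rel_reflexive_def)
  have "out_nbhd (Restr E B) {x} \<subseteq> out_nbhd E {x}" "in_nbhd (Restr E B) {x} \<subseteq> in_nbhd E {x}" for x
    by (auto simp: out_nbhd_def in_nbhd_def)
  then show "locally_finite B (Restr E B)"
    using locally_finite assms(1) unfolding locally_finite_def by (meson finite_subset subsetD)
  show "point_transitive B (Restr E B)"
    using assms rel_automorphism_Restr[OF edges_subset] unfolding point_transitive_def by metis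
qed

end

section \<open>Blocks of imprimitivity\<close>

context point_transitive_relation
begin

text \<open>The intersection of all translates of \<open>X\<close> that contain \<open>w\<close>; in terms of preimages, no inverse
  automorphisms are needed.\<close>

definition block :: "'a set \<Rightarrow> 'a \<Rightarrow> 'a set" where
  "block X w = {u \<in> V. \<forall>g. aut g \<longrightarrow> g w \<in> X \<longrightarrow> g u \<in> X}"

lemma block_subset: "block X w \<subseteq> V"
  by (auto simp: block_def)

lemma block_subset_if_mem: "u \<in> block X w \<Longrightarrow> block X u \<subseteq> block X w"
  by (auto simp: block_def)

lemma image_block_subset:
  assumes "aut h" "w \<in> V"
  shows "h ` block X w \<subseteq> block X (h w)"
  using assms aut_comp[OF assms(1)] by (force simp: block_def aut_mem)

lemma obtain_aut_block_into:
  assumes "X \<subseteq> V" "X \<noteq> {}" "w \<in> V"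
  obtains g where "aut g" "g ` block X w \<subseteq> X"
proof -
  obtain x where "x \<in> X" using assms by auto
  then obtain g where "aut g" "g w = x" using assms obtain_aut by blast
  then show thesis using that \<open>x \<in> X\<close> by (auto simp: block_def)
qed

lemma finite_block:
  assumes "X \<subseteq> V" "X \<noteq> {}" "finite X" "w \<in> V"
  shows "finite (block X w)"
proof -
  obtain g where "aut g" "g ` block X w \<subseteq> X"
    using assms(1,2,4) by (rule obtain_aut_block_into)
  then show ?thesis using aut_inj_on block_subset \<open>finite X\<close> by (metis inj_on_finite)
qed

lemma card_block_le:
  assumes "X \<subseteq> V" "X \<noteq> {}" "finite X" "w \<in> V"
  shows "card (block X w) \<le> card X"
proof -
  obtain g where "aut g" "g ` block X w \<subseteq> X"
    using assms(1,2,4) by (rule obtain_aut_block_into)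
  then show ?thesis using aut_inj_on block_subset \<open>finite X\<close> by (metis card_inj_on_le)
qed

lemma card_block_eq:
  assumes "X \<subseteq> V" "X \<noteq> {}" "finite X" "u \<in> V" "w \<in> V"
  shows "card (block X u) = card (block X w)"
proof -
  have "card (block X x) \<le> card (block X y)" if "x \<in> V" "y \<in> V" for x y
  proof -
    obtain h where "aut h" "h x = y" using \<open>x \<in> V\<close> \<open>y \<in> V\<close> by (rule obtain_aut)
    then have "h ` block X x \<subseteq> block X y" using image_block_subset that by blast
    then show ?thesis
      using aut_inj_on[OF \<open>aut h\<close> block_subset] finite_block[OF assms(1-3) \<open>y \<in> V\<close>]
      by (intro card_inj_on_le)
  qed
  then show ?thesis using assms(4,5) by (simp add: order_antisym)
qed

lemma image_block:
  assumes "X \<subseteq> V" "X \<noteq> {}" "finite X" "aut h" "w \<in> V"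
  shows "h ` block X w = block X (h w)"
proof (rule card_subset_eq)
  show "finite (block X (h w))"
    using assms aut_mem by (intro finite_block)
  show "h ` block X w \<subseteq> block X (h w)"
    using assms(4,5) by (rule image_block_subset)
  show "card (h ` block X w) = card (block X (h w))"
    unfolding card_image[OF aut_inj_on[OF \<open>aut h\<close> block_subset]]
    using assms aut_mem by (intro card_block_eq) auto
qed

lemma block_eq:
  assumes "X \<subseteq> V" "X \<noteq> {}" "finite X" "w \<in> V" "u \<in> block X w"
  shows "block X u = block X w"
proof (rule card_subset_eq)
  show "finite (block X w)" using assms(1-4) by (rule finite_block)
  show "block X u \<subseteq> block X w" using assms(5) by (rule block_subset_if_mem)
  have "u \<in> V" using assms(5) block_subset by blast
  then show "card (block X u) = card (block X w)" using assms card_block_eq by blast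
qed

lemma point_transitive_relation_block:
  assumes "X \<subseteq> V" "X \<noteq> {}" "finite X" "w \<in> V"
  shows "point_transitive_relation (block X w) (Restr E (block X w))"
proof (rule point_transitive_relation_Restr[OF block_subset])
  fix x y assume in_block: "x \<in> block X w" "y \<in> block X w"
  then have "x \<in> V" "y \<in> V" using block_subset by blast+
  then obtain h where "aut h" "h x = y" by (rule obtain_aut)
  moreover have "block X x = block X w" "block X y = block X w"
    using assms in_block block_eq by blast+
  ultimately show "\<exists>h. aut h \<and> h x = y \<and> h ` block X w = block X w"
    using image_block[OF assms(1-3)] \<open>x \<in> V\<close> by metis
qed

end

section \<open>Deficient sets\<close>

definition deficient :: "'a set \<Rightarrow> ('a \<times> 'a) set \<Rightarrow> 'a \<Rightarrow> 'a set \<Rightarrow> bool" where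
  "deficient V E v F \<longleftrightarrow> F \<subseteq> V \<and> finite F \<and> F \<inter> in_nbhd E {v} = {v} \<and>
     card (boundary E F) + 1 < card (out_nbhd E {v})"

definition minimally_deficient :: "'a set \<Rightarrow> ('a \<times> 'a) set \<Rightarrow> 'a \<Rightarrow> 'a set \<Rightarrow> bool" where
  "minimally_deficient V E v F \<longleftrightarrow>
     deficient V E v F \<and> (\<forall>w G. deficient V E w G \<longrightarrow> card F \<le> card G)"

lemma deficientD:
  assumes "deficient V E v F"
  shows "F \<subseteq> V" "finite F" "v \<in> F" "v \<in> V"
    and deficient_in_nbhd: "F \<inter> in_nbhd E {v} = {v}"
    and deficient_card_boundary: "card (boundary E F) + 1 < card (out_nbhd E {v})"
  using assms by (auto simp: deficient_def)

lemma obtain_minimally_deficient: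
  assumes "deficient V E v F"
  obtains w G where "minimally_deficient V E w G" "card G \<le> card F"
  using assms ex_has_least_nat[of "\<lambda>G. \<exists>w. deficient V E w G" F card]
  unfolding minimally_deficient_def by blast

context reflexive_locally_finite_relation
begin

lemma deficient_Restr:
  assumes "deficient V E v F" "F \<subseteq> B"
  shows "deficient B (Restr E B) v F"
proof -
  note F = deficientD[OF assms(1)]
  have boundary: "boundary (Restr E B) F = boundary E F \<inter> B"
    using assms(2) by (auto simp: boundary_def out_nbhd_def)
  have out: "out_nbhd (Restr E B) {v} = out_nbhd E {v} \<inter> B"
    using assms(2) \<open>v \<in> F\<close> by (auto simp: out_nbhd_def)
  have finite: "finite (boundary E F)" "finite (out_nbhd E {v})"
    using F finite_boundary finite_out_nbhd by auto
  have "out_nbhd E {v} - B \<subseteq> boundary E F - B"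
    using assms(2) \<open>v \<in> F\<close> by (auto simp: boundary_def out_nbhd_def)
  then have "card (out_nbhd E {v} - B) \<le> card (boundary E F - B)"
    using finite by (intro card_mono) auto
  then have "card (boundary (Restr E B) F) + 1 < card (out_nbhd (Restr E B) {v})"
    unfolding boundary out
    using deficient_card_boundary[OF assms(1)] card_Int_Diff[OF finite(1), of B]
      card_Int_Diff[OF finite(2), of B]
    by linarith
  moreover have "F \<inter> in_nbhd (Restr E B) {v} = {v}"
    using \<open>v \<in> F\<close> deficient_in_nbhd[OF assms(1)] assms(2) by (auto simp: in_nbhd_def)
  ultimately show ?thesis using \<open>finite F\<close> assms(2) by (simp add: deficient_def)
qed

lemma deficient_converse:
  assumes "F \<subseteq> V" and sole: "F \<inter> in_nbhd E {v} = {v}" and "finite (V - F)"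
    and small: "card (boundary E F) + 1 < card (in_nbhd E {v})"
  shows "deficient V (E\<inverse>) v (insert v (V - out_nbhd E F))" (is "deficient _ _ _ ?D")
proof -
  have v: "v \<in> F" "v \<in> V" using sole assms(1) by auto
  have "finite (boundary E F)"
    using \<open>finite (V - F)\<close> out_nbhd_subset[of F]
    by (auto simp: boundary_def intro: finite_subset[OF Diff_mono])
  have "finite (V - out_nbhd E F)"
    using \<open>finite (V - F)\<close> subset_out_nbhd[OF assms(1)] by (auto intro: finite_subset[OF Diff_mono])
  moreover have "?D \<inter> in_nbhd (E\<inverse>) {v} = {v}"
    using v refl_edge by (auto simp: in_nbhd_converse out_nbhd_def)
  moreover have "boundary (E\<inverse>) ?D \<subseteq> boundary E F"
  proof -
    have "in_nbhd E ?D = in_nbhd E {v} \<union> in_nbhd E (V - out_nbhd E F)"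
      by (auto simp: in_nbhd_def)
    also have "\<dots> \<subseteq> insert v (V - F)"
      using sole in_nbhd_diff_out_nbhd[of F] in_nbhd_subset[of "{v}"] by blast
    finally show ?thesis by (auto simp: boundary_def out_nbhd_converse)
  qed
  then have "card (boundary (E\<inverse>) ?D) \<le> card (boundary E F)"
    using \<open>finite (boundary E F)\<close> by (intro card_mono)
  ultimately show ?thesis
    using v small by (simp add: deficient_def out_nbhd_converse)
qed

end

context point_transitive_relation
begin

lemma deficient_image:
  assumes "deficient V E v F" "aut g"
  shows "deficient V E (g v) (g ` F)"
proof -
  note F = deficientD[OF assms(1)]
  have "g ` F \<inter> in_nbhd E {g v} = g ` F \<inter> g ` in_nbhd E {v}"
    using in_nbhd_image[OF assms(2), of "{v}"] \<open>v \<in> V\<close> by simp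
  also have "\<dots> = g ` (F \<inter> in_nbhd E {v})"
    using aut_inj_on[OF assms(2) order_refl] \<open>F \<subseteq> V\<close> in_nbhd_subset
    by (simp add: inj_on_image_Int)
  also have "\<dots> = {g v}" using deficient_in_nbhd[OF assms(1)] by simp
  finally have "g ` F \<inter> in_nbhd E {g v} = {g v}" .
  moreover have "card (boundary E (g ` F)) = card (boundary E F)"
    using assms(2) \<open>F \<subseteq> V\<close> by (simp add: boundary_image card_image aut_inj_on boundary_subset)
  moreover have "card (out_nbhd E {g v}) = card (out_nbhd E {v})"
    using assms(2) \<open>v \<in> V\<close> aut_mem card_out_nbhd_singleton_eq by blast
  ultimately show ?thesis
    using F assms(2) aut_mem by (auto simp: deficient_def)
qed

lemma minimally_deficient_image:
  assumes "minimally_deficient V E v F" "aut g"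
  shows "minimally_deficient V E (g v) (g ` F)"
proof -
  have "F \<subseteq> V" using assms(1) by (simp add: minimally_deficient_def deficient_def)
  then have "card (g ` F) = card F" using assms(2) by (simp add: card_image aut_inj_on)
  then show ?thesis using assms deficient_image by (simp add: minimally_deficient_def)
qed

lemma obtain_deficient_converse:
  assumes "finite V" "deficient V E v F"
  obtains D where "deficient V (E\<inverse>) v D" "card D + card F + card (boundary E F) \<le> card V + 1"
proof
  let ?D = "insert v (V - out_nbhd E F)"
  note F = deficientD[OF assms(2)]
  show "deficient V (E\<inverse>) v ?D"
    using F assms(1) card_in_nbhd_singleton_eq by (intro deficient_converse) auto
  have "card ?D \<le> card (V - out_nbhd E F) + 1"
    using card_insert_le_m1[of "card (V - out_nbhd E F) + 1" "V - out_nbhd E F"] by simp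
  then show "card ?D + card F + card (boundary E F) \<le> card V + 1"
    using card_diff_out_nbhd[OF assms(1) \<open>F \<subseteq> V\<close>] by linarith
qed

end

section \<open>Fragments\<close>

definition separating :: "'a set \<Rightarrow> ('a \<times> 'a) set \<Rightarrow> 'a set \<Rightarrow> bool" where
  "separating V E X \<longleftrightarrow> X \<subseteq> V \<and> finite X \<and> X \<noteq> {} \<and> out_nbhd E X \<noteq> V"

definition fragment :: "'a set \<Rightarrow> ('a \<times> 'a) set \<Rightarrow> 'a set \<Rightarrow> bool" where
  "fragment V E X \<longleftrightarrow> separating V E X \<and>
     (\<forall>Y. separating V E Y \<longrightarrow> card (boundary E X) \<le> card (boundary E Y))"

lemma fragmentD:
  assumes "fragment V E X"
  shows "X \<subseteq> V" "finite X" "X \<noteq> {}" "separating V E X"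
  using assms by (auto simp: fragment_def separating_def)

lemma obtain_fragment:
  assumes "separating V E Y"
  obtains X where "fragment V E X" "card (boundary E X) \<le> card (boundary E Y)"
  using assms ex_has_least_nat[of "separating V E" Y "\<lambda>X. card (boundary E X)"]
  unfolding fragment_def by blast

context reflexive_locally_finite_relation
begin

lemma card_separating_less:
  assumes "finite V" "separating V E X"
  shows "card X < card V"
  using assms subset_out_nbhd[of V] out_nbhd_subset[of V]
  by (intro psubset_card_mono) (auto simp: separating_def)

lemma separating_converse:
  assumes "finite V" "separating V E X"
  shows "separating V (E\<inverse>) (V - out_nbhd E X)"
  using assms in_nbhd_diff_out_nbhd[of X] out_nbhd_subset[of X]
  by (auto simp: separating_def out_nbhd_converse)

lemma card_boundary_converse_le:
  assumes "finite X" "X \<subseteq> V"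
  shows "card (boundary (E\<inverse>) (V - out_nbhd E X)) \<le> card (boundary E X)"
proof (rule card_mono)
  show "finite (boundary E X)" using assms by (rule finite_boundary)
  show "boundary (E\<inverse>) (V - out_nbhd E X) \<subseteq> boundary E X"
    using in_nbhd_diff_out_nbhd[of X] by (auto simp: boundary_def out_nbhd_converse)
qed

lemma fragment_converse:
  assumes "finite V" "fragment V E X"
  shows "fragment V (E\<inverse>) (V - out_nbhd E X)"
  unfolding fragment_def
proof (intro conjI allI impI)
  interpret conv: reflexive_locally_finite_relation V "E\<inverse>" by (rule converse)
  show "separating V (E\<inverse>) (V - out_nbhd E X)"
    using assms(1) fragmentD(4)[OF assms(2)] by (rule separating_converse)
  fix Y assume separating_Y: "separating V (E\<inverse>) Y"
  have "card (boundary (E\<inverse>) (V - out_nbhd E X)) \<le> card (boundary E X)"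
    using fragmentD[OF assms(2)] by (intro card_boundary_converse_le)
  also have "\<dots> \<le> card (boundary E (V - out_nbhd (E\<inverse>) Y))"
    using assms conv.separating_converse[OF assms(1) separating_Y] by (simp add: fragment_def)
  also have "\<dots> \<le> card (boundary (E\<inverse>) Y)"
    using conv.card_boundary_converse_le[of Y] separating_Y by (simp add: separating_def)
  finally show "card (boundary (E\<inverse>) (V - out_nbhd E X)) \<le> card (boundary (E\<inverse>) Y)" .
qed

lemma card_boundary_fragment_le:
  assumes "fragment V E X" "Q \<subseteq> V" "finite Q" "Q \<noteq> {}"
    and "finite V \<Longrightarrow> card Q + card (boundary E X) \<le> card V"
  shows "card (boundary E X) \<le> card (boundary E Q)"
proof (cases "out_nbhd E Q = V")
  case True
  then have "finite V" using assms(2,3) finite_out_nbhd by metis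
  then show ?thesis using assms(5) card_out_nbhd[OF assms(3,2)] True by simp
next
  case False
  then show ?thesis using assms by (simp add: fragment_def separating_def)
qed

lemma minimally_deficient_subset_fragment:
  assumes minimal: "minimally_deficient V E v F" and fragment: "fragment V E X" and "v \<in> X"
    and room: "finite V \<Longrightarrow> card X + card F + card (boundary E X) \<le> card V + 1"
  shows "F \<subseteq> X"
proof (rule ccontr)
  assume "\<not> F \<subseteq> X"
  have deficient: "deficient V E v F"
    and least: "\<And>G. deficient V E v G \<Longrightarrow> card F \<le> card G"
    using minimal by (auto simp: minimally_deficient_def)
  note F = deficientD[OF deficient] and X = fragmentD[OF fragment]
  have "card (F \<inter> X) < card F"
    using \<open>\<not> F \<subseteq> X\<close> \<open>finite F\<close> by (intro psubset_card_mono) auto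
  then have "\<not> deficient V E v (F \<inter> X)" using least leD by blast
  then have "card (out_nbhd E {v}) \<le> card (boundary E (F \<inter> X)) + 1"
    using deficient \<open>v \<in> X\<close> by (auto simp: deficient_def)
  moreover have "card (boundary E X) \<le> card (boundary E (F \<union> X))"
  proof (rule card_boundary_fragment_le[OF fragment])
    have "card (F \<inter> X) > 0" using \<open>finite F\<close> \<open>v \<in> F\<close> \<open>v \<in> X\<close> by (auto simp: card_gt_0_iff)
    then show "card (F \<union> X) + card (boundary E X) \<le> card V" if "finite V"
      using room[OF that] card_Un_Int[OF \<open>finite F\<close> \<open>finite X\<close>] by linarith
  qed (use F X in auto)
  ultimately show False
    using deficient_card_boundary[OF deficient]
      boundary_submodular[OF \<open>finite F\<close> \<open>F \<subseteq> V\<close> \<open>finite X\<close> \<open>X \<subseteq> V\<close>]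
    by linarith
qed

end

context point_transitive_relation
begin

lemma deficient_separating:
  assumes "deficient V E v F"
  shows "separating V E F"
proof -
  note F = deficientD[OF assms]
  have "out_nbhd E F \<noteq> V"
  proof
    assume full: "out_nbhd E F = V"
    then have "finite V" using \<open>F \<subseteq> V\<close> \<open>finite F\<close> finite_out_nbhd by metis
    have "in_nbhd E {v} \<subseteq> insert v (boundary E F)"
      using deficient_in_nbhd[OF assms] full in_nbhd_subset[of "{v}"] by (auto simp: boundary_def)
    then have "card (in_nbhd E {v}) \<le> card (insert v (boundary E F))"
      using \<open>F \<subseteq> V\<close> \<open>finite F\<close> finite_boundary by (intro card_mono) auto
    also have "\<dots> \<le> card (boundary E F) + 1"
      using card_insert_le_m1[of "card (boundary E F) + 1" "boundary E F"] by simp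
    finally show False
      using deficient_card_boundary[OF assms] card_in_nbhd_singleton_eq[OF \<open>finite V\<close> \<open>v \<in> V\<close>]
      by simp
  qed
  then show ?thesis using \<open>F \<subseteq> V\<close> \<open>finite F\<close> \<open>v \<in> F\<close> by (auto simp: separating_def)
qed

lemma obtain_smaller_deficient_relation:
  assumes minimal: "minimally_deficient V E v F" and fragment: "fragment V E X"
    and room: "finite V \<Longrightarrow> card X + card F + card (boundary E X) \<le> card V + 1"
  obtains B where "finite B" "card B \<le> card X"
    "point_transitive_relation B (Restr E B)" "deficient B (Restr E B) v F"
proof
  have deficient: "deficient V E v F" using minimal by (simp add: minimally_deficient_def)
  note F = deficientD[OF deficient] and X = fragmentD[OF fragment]
  show "finite (block X v)"
    using \<open>X \<subseteq> V\<close> \<open>X \<noteq> {}\<close> \<open>finite X\<close> \<open>v \<in> V\<close> by (rule finite_block)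
  show "card (block X v) \<le> card X"
    using \<open>X \<subseteq> V\<close> \<open>X \<noteq> {}\<close> \<open>finite X\<close> \<open>v \<in> V\<close> by (rule card_block_le)
  show "point_transitive_relation (block X v) (Restr E (block X v))"
    using \<open>X \<subseteq> V\<close> \<open>X \<noteq> {}\<close> \<open>finite X\<close> \<open>v \<in> V\<close> by (rule point_transitive_relation_block)
  have "g ` F \<subseteq> X" if "aut g" "g v \<in> X" for g
  proof (rule minimally_deficient_subset_fragment[OF _ fragment])
    show "minimally_deficient V E (g v) (g ` F)"
      using minimal that(1) by (rule minimally_deficient_image)
    show "card X + card (g ` F) + card (boundary E X) \<le> card V + 1" if "finite V"
      using room[OF that] \<open>aut g\<close> \<open>F \<subseteq> V\<close> by (simp add: card_image aut_inj_on)
  qed (fact that)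
  then have "F \<subseteq> block X v" using \<open>F \<subseteq> V\<close> by (auto simp: block_def)
  with deficient show "deficient (block X v) (Restr E (block X v)) v F"
    by (rule deficient_Restr)
qed

lemma obtain_fragment_with_room:
  assumes "finite V" "deficient V E v F"
  obtains (direct) w G X where "minimally_deficient V E w G" "fragment V E X"
      "card X + card G + card (boundary E X) \<le> card V + 1"
    | (converse) w G X where "minimally_deficient V (E\<inverse>) w G" "fragment V (E\<inverse>) X"
      "card X + card G + card (boundary (E\<inverse>) X) \<le> card V + 1"
proof -
  obtain v F where minimal_F: "minimally_deficient V E v F"
    using assms(2) by (rule obtain_minimally_deficient)
  then have deficient: "deficient V E v F" by (simp add: minimally_deficient_def)
  obtain D where "deficient V (E\<inverse>) v D"
      and card_D: "card D + card F + card (boundary E F) \<le> card V + 1"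
    using assms(1) deficient by (rule obtain_deficient_converse)
  obtain w G where minimal_G: "minimally_deficient V (E\<inverse>) w G" and "card G \<le> card D"
    using \<open>deficient V (E\<inverse>) v D\<close> by (rule obtain_minimally_deficient)
  obtain X where fragment_X: "fragment V E X" and "card (boundary E X) \<le> card (boundary E F)"
    using deficient_separating[OF deficient] by (rule obtain_fragment)
  define N where "N = V - out_nbhd E X"
  have fragment_N: "fragment V (E\<inverse>) N"
    using assms(1) fragment_X unfolding N_def by (rule fragment_converse)
  have "card N + card X + card (boundary E X) = card V"
    using assms(1) fragmentD(1)[OF fragment_X] unfolding N_def by (rule card_diff_out_nbhd)
  moreover have "card (boundary (E\<inverse>) N) \<le> card (boundary E X)"
    using fragmentD(2,1)[OF fragment_X] unfolding N_def by (rule card_boundary_converse_le)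
  ultimately consider "card X + card F + card (boundary E X) \<le> card V + 1"
    | "card N + card G + card (boundary (E\<inverse>) N) \<le> card V + 1"
    using card_D \<open>card G \<le> card D\<close> \<open>card (boundary E X) \<le> card (boundary E F)\<close> by linarith
  then show thesis
    using direct[OF minimal_F fragment_X] converse[OF minimal_G fragment_N] by cases
qed

end

section \<open>Nonexistence of deficient sets\<close>

lemma not_deficient_finite:
  assumes "point_transitive_relation V E" "finite V"
  shows "\<not> deficient V E v F"
  using assms
proof (induction "card V" arbitrary: V E v F rule: less_induct)
  case less
  interpret point_transitive_relation V E by (fact less.prems)
  interpret conv: point_transitive_relation V "E\<inverse>"
    by (rule point_transitive_relation_converse)
  show ?case
  proof
    assume "deficient V E v F"
    with \<open>finite V\<close> show False
    proof (cases rule: obtain_fragment_with_room)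
      case (direct w G X)
      then obtain B where "finite B" "card B \<le> card X"
          "point_transitive_relation B (Restr E B)" "deficient B (Restr E B) w G"
        using obtain_smaller_deficient_relation by blast
      moreover have "card X < card V"
        using \<open>finite V\<close> fragmentD(4)[OF direct(2)] by (rule card_separating_less)
      ultimately show False using less.hyps by simp
    next
      case (converse w G X)
      then obtain B where "finite B" "card B \<le> card X"
          "point_transitive_relation B (Restr (E\<inverse>) B)" "deficient B (Restr (E\<inverse>) B) w G"
        using conv.obtain_smaller_deficient_relation by blast
      moreover have "card X < card V"
        using \<open>finite V\<close> fragmentD(4)[OF converse(2)] by (rule conv.card_separating_less)
      ultimately show False using less.hyps by simp
    qed
  qed
qed

lemma (in point_transitive_relation) not_deficient: "\<not> deficient V E v F"
proof (cases "finite V")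
  case True
  with point_transitive_relation_axioms show ?thesis by (rule not_deficient_finite)
next
  case False
  show ?thesis
  proof
    assume "deficient V E v F"
    then obtain v F where minimal: "minimally_deficient V E v F"
      by (rule obtain_minimally_deficient)
    then have "separating V E F"
      by (auto simp: minimally_deficient_def intro: deficient_separating)
    then obtain X where fragment: "fragment V E X" by (rule obtain_fragment)
    obtain B where "finite B" "point_transitive_relation B (Restr E B)"
        "deficient B (Restr E B) v F"
      by (rule obtain_smaller_deficient_relation[OF minimal fragment]) (use False in simp)
    then show False using not_deficient_finite[of B "Restr E B" v F] by simp
  qed
qed

theorem theorem5p1:
  fixes V :: "'a set" and E :: "('a \<times> 'a) set" and v :: 'a and F :: "'a set"
  assumes "is_relation V E"
    and "point_transitive V E"
    and "rel_reflexive V E"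
    and "locally_finite V E"
    and "v \<in> V"
    and "F \<subseteq> V"
    and "F \<inter> in_nbhd E {v} = {v}"
  shows "(finite F \<longrightarrow>
            card (out_nbhd E F - F) \<ge> card (out_nbhd E {v}) - 1)
       \<and> (finite (V - F) \<longrightarrow>
            card (out_nbhd E F - F) \<ge> card (in_nbhd E {v}) - 1)"
proof (intro conjI impI)
  interpret point_transitive_relation V E by unfold_locales (fact assms)+
  interpret conv: point_transitive_relation V "E\<inverse>"
    by (rule point_transitive_relation_converse)
  show "card (out_nbhd E F - F) \<ge> card (out_nbhd E {v}) - 1" if "finite F"
    using not_deficient[of v F] that assms(6,7) by (auto simp: deficient_def boundary_def)
  show "card (out_nbhd E F - F) \<ge> card (in_nbhd E {v}) - 1" if "finite (V - F)"
    using deficient_converse[OF assms(6,7) that] conv.not_deficient[of v]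
    by (fastforce simp: boundary_def)
qed

end
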